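(* Let $d \ge 1$ and let $\{R_1,\dots,R_m,f_1,\dots,f_n\}$ ($m,n>0$) be an R-IFS on $\mathbb{R}^d$. Then there exists a minimal invariant set $X_0$ of this R-IFS; that is, there is an invariant set $X_0$ of the R-IFS such that $X_0\subset S$ for every invariant set $S$ of the R-IFS.
   Context: $\mathbb{R}^d$ carries the Euclidean norm. A map $f$ on a metric space $(X,\rho)$ is a (Banach) contraction if there is $\alpha\in[0,1)$ with $\rho(f(x),f(y))\le\alpha\,\rho(x,y)$ for all $x,y$; it is isometric if $\rho(f(x),f(y))=\rho(x,y)$ for all $x,y$. An R-IFS on $\mathbb{R}^d$ is a function system $\{R_1,\dots,R_m,f_1,\dots,f_n\}$ with $m,n>0$, where each $R_i:\mathbb{R}^d\to\mathbb{R}^d$ is an isometric mapping with $R_i(0)=0$ and each $f_j:\mathbb{R}^d\to\mathbb{R}^d$ is a contraction. An invariant set of a finite system $\mathcal{F}$ of continuous self-maps of $X$ is a nonempty closed set $A\subset X$ with $\bigcup_{f\in\mathcal{F}} f(A)=A$. A minimal invariant set of $\mathcal{F}$ is an invariant set of $\mathcal{F}$ contained in every invariant set of $\mathcal{F}$. *)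

theory Defs
  imports "HOL-Analysis.Analysis"
begin

definition contraction :: "('a::metric_space \<Rightarrow> 'a) \<Rightarrow> bool" where
  "contraction f \<longleftrightarrow>
     (\<exists>\<alpha>\<in>{0..<1}. \<forall>x y. dist (f x) (f y) \<le> \<alpha> * dist x y)"

definition isometric :: "('a::metric_space \<Rightarrow> 'a) \<Rightarrow> bool" where
  "isometric f \<longleftrightarrow> (\<forall>x y. dist (f x) (f y) = dist x y)"

definition R_IFS ::
  "nat \<Rightarrow> nat \<Rightarrow> (nat \<Rightarrow> real ^ 'd \<Rightarrow> real ^ 'd) \<Rightarrow> (nat \<Rightarrow> real ^ 'd \<Rightarrow> real ^ 'd) \<Rightarrow> bool" where
  "R_IFS m n R f \<longleftrightarrow> m > 0 \<and> n > 0 \<and>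
     (\<forall>i\<in>{1..m}. isometric (R i) \<and> R i 0 = 0) \<and>
     (\<forall>j\<in>{1..n}. contraction (f j))"

text \<open>Only the set of maps matters for invariance, so the indexed families are
  collapsed to a set; repetitions among the maps are allowed and play no role.\<close>

definition R_IFS_maps ::
  "nat \<Rightarrow> nat \<Rightarrow> (nat \<Rightarrow> real ^ 'd \<Rightarrow> real ^ 'd) \<Rightarrow> (nat \<Rightarrow> real ^ 'd \<Rightarrow> real ^ 'd)
     \<Rightarrow> (real ^ 'd \<Rightarrow> real ^ 'd) set" where
  "R_IFS_maps m n R f = R ` {1..m} \<union> f ` {1..n}"

text \<open>Finiteness of the system and continuity of its maps are not part of the
  predicate; both hold automatically for \<^const>\<open>R_IFS_maps\<close> of an \<^const>\<open>R_IFS\<close>.\<close>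

definition invariant_set :: "('a::topological_space \<Rightarrow> 'a) set \<Rightarrow> 'a set \<Rightarrow> bool" where
  "invariant_set F A \<longleftrightarrow> A \<noteq> {} \<and> closed A \<and> (\<Union>g\<in>F. g ` A) = A"

definition minimal_invariant_set :: "('a::topological_space \<Rightarrow> 'a) set \<Rightarrow> 'a set \<Rightarrow> bool" where
  "minimal_invariant_set F A \<longleftrightarrow>
     invariant_set F A \<and> (\<forall>S. invariant_set F S \<longrightarrow> A \<subseteq> S)"

end

theory Submission
  imports Defs
begin

text \<open>Every nonempty closed set that the system maps into itself contains the fixed point of the
  contraction \<open>f\<^sub>1\<close>, so the intersection \<open>X\<close> of all such sets is again one. A large ball around the
  origin is such a set, hence \<open>X\<close> is compact; its image under the system is therefore closed, and
  so a competitor itself, which gives \<open>X \<subseteq> F X\<close>.\<close>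

lemma contraction_continuous:
  assumes "contraction f"
  shows "continuous_on A f"
proof -
  obtain a where a: "0 \<le> a" "\<And>x y. dist (f x) (f y) \<le> a * dist x y"
    using assms by (auto simp: contraction_def)
  have "a-lipschitz_on A f"
    using a by (intro lipschitz_onI)
  then show ?thesis
    by (rule lipschitz_on_continuous_on)
qed

lemma isometric_continuous:
  assumes "isometric f"
  shows "continuous_on A f"
proof -
  have "1-lipschitz_on A f"
    using assms by (intro lipschitz_onI) (auto simp: isometric_def)
  then show ?thesis
    by (rule lipschitz_on_continuous_on)
qed

text \<open>A closed subset of a complete space is complete, so Banach's theorem yields a fixed
  point inside each such \<open>S\<close>. Uniqueness on the whole space makes it the same point
  \<open>p\<close> for every \<open>S\<close>.\<close>

lemma contraction_fixed_point_in_closed_sets: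
  fixes f :: "'a::complete_space \<Rightarrow> 'a"
  assumes "contraction f"
  obtains p where "\<And>S. closed S \<Longrightarrow> S \<noteq> {} \<Longrightarrow> f ` S \<subseteq> S \<Longrightarrow> p \<in> S"
proof -
  obtain a where a: "0 \<le> a" "a < 1" "\<And>x y. dist (f x) (f y) \<le> a * dist x y"
    using assms by (auto simp: contraction_def)
  have fix_in: "\<exists>!x\<in>S. f x = x" if "closed S" "S \<noteq> {}" "f ` S \<subseteq> S" for S
    using that a by (intro Banach_fix[of S a f]) (auto simp: complete_eq_closed)
  obtain p where "f p = p" and "\<And>x. f x = x \<Longrightarrow> x = p"
    using fix_in[of UNIV] by auto
  then show thesis
    using fix_in by (metis that)
qed

text \<open>With contraction factor \<open>a\<close>,
  \<open>norm (f x) \<le> a * r + norm (f 0)\<close> on the ball, which is at most \<open>r\<close>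
  once \<open>r \<ge> norm (f 0) / (1 - a)\<close>. Having all larger radii too lets one ball serve
  several contractions.\<close>

lemma contraction_cball_invariant:
  fixes f :: "'a::real_normed_vector \<Rightarrow> 'a"
  assumes "contraction f"
  shows "\<exists>r0. \<forall>r\<ge>r0. f ` cball 0 r \<subseteq> cball 0 r"
proof -
  obtain a where a: "0 \<le> a" "a < 1" "\<And>x y. dist (f x) (f y) \<le> a * dist x y"
    using assms by (auto simp: contraction_def)
  have "norm (f x) \<le> r" if r: "norm (f 0) / (1 - a) \<le> r" and x: "norm x \<le> r" for r x
  proof -
    have "norm (f x) \<le> norm (f x - f 0) + norm (f 0)"
      by (metis diff_add_cancel norm_triangle_ineq)
    also have "\<dots> \<le> a * norm x + norm (f 0)"
      using a(3)[of x 0] by (simp add: dist_norm)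
    also have "\<dots> \<le> a * r + (1 - a) * r"
      using r a x by (intro add_mono mult_left_mono) (auto simp: field_simps)
    finally show ?thesis
      by (simp add: algebra_simps)
  qed
  then show ?thesis
    by (auto intro!: exI[of _ "norm (f 0) / (1 - a)"])
qed

lemma minimal_invariant_set_exists:
  fixes F :: "('a::complete_space \<Rightarrow> 'a) set"
  assumes "finite F" and cont: "\<And>g. g \<in> F \<Longrightarrow> continuous_on UNIV g"
    and "f \<in> F" "contraction f"
    and K: "compact K" "K \<noteq> {}" "(\<Union>g\<in>F. g ` K) \<subseteq> K"
  shows "\<exists>X. minimal_invariant_set F X"
proof -
  \<comment> \<open>Inclusion replaces equality here because, unlike equality, it passes to
    arbitrary intersections.\<close>
  define \<S> where "\<S> = {S. closed S \<and> S \<noteq> {} \<and> (\<Union>g\<in>F. g ` S) \<subseteq> S}"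
  define X where "X = \<Inter>\<S>"
  obtain p where "\<And>S. closed S \<Longrightarrow> S \<noteq> {} \<Longrightarrow> f ` S \<subseteq> S \<Longrightarrow> p \<in> S"
    using contraction_fixed_point_in_closed_sets[OF \<open>contraction f\<close>] by blast
  then have "p \<in> X"
    using \<open>f \<in> F\<close> by (auto simp: X_def \<S>_def)
  have "closed X"
    by (auto simp: X_def \<S>_def intro: closed_Inter)
  have "K \<in> \<S>"
    using K by (auto simp: \<S>_def compact_imp_closed)
  then have "compact X"
    using compact_Int_closed[OF K(1) \<open>closed X\<close>]
    by (simp add: X_def Inter_lower Int_absorb1)
  have forward: "(\<Union>g\<in>F. g ` X) \<subseteq> X"
    unfolding X_def \<S>_def by blast
  have "compact (\<Union>g\<in>F. g ` X)"
    using \<open>finite F\<close> \<open>compact X\<close> cont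
    by (intro compact_UN compact_continuous_image) (auto intro: continuous_on_subset)
  \<comment> \<open>Taking images is monotone, so applying the system to both sides of
    \<open>forward\<close> gives this.\<close>
  moreover have "(\<Union>g\<in>F. g ` (\<Union>g\<in>F. g ` X)) \<subseteq> (\<Union>g\<in>F. g ` X)"
    using forward by blast
  ultimately have "(\<Union>g\<in>F. g ` X) \<in> \<S>"
    using \<open>p \<in> X\<close> \<open>f \<in> F\<close> unfolding \<S>_def
    by (blast intro: compact_imp_closed)
  then have "(\<Union>g\<in>F. g ` X) = X"
    using forward by (auto simp: X_def)
  then have "invariant_set F X"
    using \<open>closed X\<close> \<open>p \<in> X\<close> by (auto simp: invariant_set_def)
  moreover have "X \<subseteq> S" if "invariant_set F S" for S
    using that by (auto simp: X_def \<S>_def invariant_set_def)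
  ultimately show ?thesis
    by (auto simp: minimal_invariant_set_def)
qed

theorem theorem3:
  fixes R f :: "nat \<Rightarrow> real ^ 'd \<Rightarrow> real ^ 'd" and m n :: nat
  assumes "R_IFS m n R f"
  shows "\<exists>X0. minimal_invariant_set (R_IFS_maps m n R f) X0"
proof -
  have "n > 0" and R: "\<And>i. i \<in> {1..m} \<Longrightarrow> isometric (R i) \<and> R i 0 = 0"
    and f: "\<And>j. j \<in> {1..n} \<Longrightarrow> contraction (f j)"
    using assms by (auto simp: R_IFS_def)
  let ?F = "R_IFS_maps m n R f"
  obtain b where b: "\<And>j r. j \<in> {1..n} \<Longrightarrow> b j \<le> r \<Longrightarrow> f j ` cball 0 r \<subseteq> cball 0 r"
    using contraction_cball_invariant[OF f] by metis
  \<comment> \<open>The largest of the finitely many thresholds works for all \<open>f j\<close>;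
    the inserted \<open>0\<close> keeps the ball nonempty.\<close>
  define r where "r = Max (insert 0 (b ` {1..n}))"
  have "0 \<le> r" and "\<And>j. j \<in> {1..n} \<Longrightarrow> b j \<le> r"
    unfolding r_def by (rule Max_ge; simp)+
  have "f j ` cball 0 r \<subseteq> cball 0 r" if "j \<in> {1..n}" for j
    using b that \<open>\<And>j. j \<in> {1..n} \<Longrightarrow> b j \<le> r\<close> by blast
  \<comment> \<open>An isometry fixing the origin preserves the norm, so it maps every ball around
    \<open>0\<close> into itself.\<close>
  moreover have "R i ` cball 0 r \<subseteq> cball 0 r" if "i \<in> {1..m}" for i
    using R[OF that] by (metis image_subsetI isometric_def mem_cball)
  ultimately have ball: "(\<Union>g\<in>?F. g ` cball 0 r) \<subseteq> cball 0 r"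
    unfolding R_IFS_maps_def by blast
  \<comment> \<open>Here \<open>n > 0\<close> supplies the contraction that pins down the common
    point.\<close>
  have "f 1 \<in> ?F" "contraction (f 1)" "finite ?F"
    using \<open>n > 0\<close> f by (auto simp: R_IFS_maps_def)
  moreover have "continuous_on UNIV g" if "g \<in> ?F" for g
    using that R f
    by (auto simp: R_IFS_maps_def intro: contraction_continuous isometric_continuous)
  ultimately show ?thesis
    using minimal_invariant_set_exists[of ?F "f 1" "cball 0 r"] ball \<open>0 \<le> r\<close> by simp
qed

end
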